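(* Let $\gamma:I\to M\subset G^3$ be a unit speed geodesic curve on a surface $M$ in the Galilean space $G^3$ (that is, $\kappa_g\equiv0$), with normal curvature $\kappa_n$ and geodesic torsion $\tau_g$. Then the position vectors of the special Smarandache curves of $\gamma$ are $$\alpha^g_{\mathbf{TN}}=\left(1,\ \int\kappa_n\cos\Big(\int\tau_g dx\Big)dx+\cos\Big(\int\tau_g dx\Big),\ -\int\kappa_n\sin\Big(\int\tau_g dx\Big)dx-\sin\Big(\int\tau_g dx\Big)\right),$$ $$\alpha^g_{\mathbf{TB}}=\left(1,\ \int\kappa_n\cos\Big(\int\tau_g dx\Big)dx+\sin\Big(\int\tau_g dx\Big),\ -\int\kappa_n\sin\Big(\int\tau_g dx\Big)dx+\cos\Big(\int\tau_g dx\Big)\right),$$ $$\alpha^g_{\mathbf{TNB}}=\left(1,\ \int\kappa_n\cos\Big(\int\tau_g dx\Big)dx+\cos\Big(\int\tau_g dx\Big)+\sin\Big(\int\tau_g dx\Big),\ -\int\kappa_n\sin\Big(\int\tau_g dx\Big)dx+\cos\Big(\int\tau_g dx\Big)-\sin\Big(\int\tau_g dx\Big)\right).$$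
   Context: Galilean space $G^3$ is $\mathbb{R}^3$ with scalar product $v\cdot_G w=v_1w_1$ if $v_1\ne0$ or $w_1\neq 0$, and $v\cdot_G w=v_2w_2+v_3w_3$ if $v_1=w_1=0$; norm $\|v\|_G=\sqrt{|v\cdot_G v|}$; cross product $v\times_G w=(0,\ v_3w_1-v_1w_3,\ v_1w_2-v_2w_1)$. A vector is isotropic if its first component is $0$. A unit speed curve is written $\gamma(x)=(x,y(x),z(x))$, $x\in I\subset\mathbb{R}$; its curvature is $\kappa=\|\gamma''\|_G$ (assumed $>0$) and its Frenet frame is $\mathbf T=\gamma'$, $\mathbf N=\gamma''/\kappa$, $\mathbf B=\mathbf T\times_G\mathbf N=\frac1\kappa(0,-z'',y'')$. For a curve $\gamma$ on a surface $M$, $\mathbf n$ is the unit normal vector field of $M$ along $\gamma$ (the isotropic unit vector field in the direction of $\phi_u\times_G\phi_v$ for a local parametrization $\phi(u,v)$ of $M$), and $\mathbf Q=\mathbf n\times_G\mathbf T$. The geodesic curvature $\kappa_g$, normal curvature $\kappa_n$ and geodesic torsion $\tau_g$ are the functions of $x$ in the Darboux formulas $\mathbf T'=\kappa_g\mathbf Q+\kappa_n\mathbf n$, $\mathbf Q'=\tau_g\mathbf n$, $\mathbf n'=-\tau_g\mathbf Q$. One has $\kappa^2=\kappa_g^2+\kappa_n^2$. Special Smarandache curves of $\gamma$ (here denoted $\alpha^g$ with the corresponding subscript): the $\mathbf{TN}$ curve is $\mathbf T+\mathbf N$, the $\mathbf{TB}$ curve is $\mathbf T+\mathbf B$, the $\mathbf{TNB}$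 curve is $\mathbf T+\mathbf N+\mathbf B$. Integral signs denote indefinite integrals.
   Formalization: As printed the formulas fail for a helix on a cylinder: with Q = n×T, τ_g must be replaced by −τ_g; they hold verbatim for Q = T×n. Both versions are proved. The unit normal is oriented so that κ_n > 0, since the formulas use N = n. *)

theory Defs
  imports "HOL-Analysis.Analysis"
begin

definition gal_inner :: "real^3 \<Rightarrow> real^3 \<Rightarrow> real" where
  "gal_inner v w =
     (if v $ 1 \<noteq> 0 \<or> w $ 1 \<noteq> 0 then v $ 1 * w $ 1 else v $ 2 * w $ 2 + v $ 3 * w $ 3)"

definition gal_norm :: "real^3 \<Rightarrow> real" where
  "gal_norm v = sqrt \<bar>gal_inner v v\<bar>"

definition gal_cross :: "real^3 \<Rightarrow> real^3 \<Rightarrow> real^3" where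
  "gal_cross v w = vector [0, v $ 3 * w $ 1 - v $ 1 * w $ 3, v $ 1 * w $ 2 - v $ 2 * w $ 1]"

text \<open>The parameter interval may contain its endpoints, so all derivatives are taken within it;
  it has to be non-degenerate for these to be unique.\<close>

definition param_interval :: "real set \<Rightarrow> bool" where
  "param_interval I \<longleftrightarrow> is_interval I \<and> (\<exists>a\<in>I. \<exists>b\<in>I. a < b)"

definition tangent :: "real set \<Rightarrow> (real \<Rightarrow> real^3) \<Rightarrow> real \<Rightarrow> real^3" where
  "tangent I \<gamma> x = vector_derivative \<gamma> (at x within I)"

definition accel :: "real set \<Rightarrow> (real \<Rightarrow> real^3) \<Rightarrow> real \<Rightarrow> real^3" where
  "accel I \<gamma> x = vector_derivative (tangent I \<gamma>) (at x within I)"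

definition unit_speed_curve :: "real set \<Rightarrow> (real \<Rightarrow> real^3) \<Rightarrow> bool" where
  "unit_speed_curve I \<gamma> \<longleftrightarrow>
     (\<forall>x\<in>I. \<gamma> x $ 1 = x \<and> \<gamma> differentiable (at x within I)
        \<and> tangent I \<gamma> differentiable (at x within I))"

definition gal_curvature :: "real set \<Rightarrow> (real \<Rightarrow> real^3) \<Rightarrow> real \<Rightarrow> real" where
  "gal_curvature I \<gamma> x = gal_norm (accel I \<gamma> x)"

definition principal_normal :: "real set \<Rightarrow> (real \<Rightarrow> real^3) \<Rightarrow> real \<Rightarrow> real^3" where
  "principal_normal I \<gamma> x = (1 / gal_curvature I \<gamma> x) *\<^sub>R accel I \<gamma> x"

definition binormal :: "real set \<Rightarrow> (real \<Rightarrow> real^3) \<Rightarrow> real \<Rightarrow> real^3" where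
  "binormal I \<gamma> x = gal_cross (tangent I \<gamma> x) (principal_normal I \<gamma> x)"

definition smarandache_TN :: "real set \<Rightarrow> (real \<Rightarrow> real^3) \<Rightarrow> real \<Rightarrow> real^3" where
  "smarandache_TN I \<gamma> x = tangent I \<gamma> x + principal_normal I \<gamma> x"

definition smarandache_TB :: "real set \<Rightarrow> (real \<Rightarrow> real^3) \<Rightarrow> real \<Rightarrow> real^3" where
  "smarandache_TB I \<gamma> x = tangent I \<gamma> x + binormal I \<gamma> x"

definition smarandache_TNB :: "real set \<Rightarrow> (real \<Rightarrow> real^3) \<Rightarrow> real \<Rightarrow> real^3" where
  "smarandache_TNB I \<gamma> x = tangent I \<gamma> x + principal_normal I \<gamma> x + binormal I \<gamma> x"

definition partial_u :: "(real \<times> real \<Rightarrow> real^3) \<Rightarrow> real \<times> real \<Rightarrow> real^3" where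
  "partial_u \<phi> p = vector_derivative (\<lambda>s. \<phi> (s, snd p)) (at (fst p))"

definition partial_v :: "(real \<times> real \<Rightarrow> real^3) \<Rightarrow> real \<times> real \<Rightarrow> real^3" where
  "partial_v \<phi> p = vector_derivative (\<lambda>s. \<phi> (fst p, s)) (at (snd p))"

text \<open>The Euclidean cross product only serves to express linear independence of the partial
  derivatives.  Patches of class C1 suffice to define the normal.\<close>

definition local_param ::
    "(real^3) set \<Rightarrow> (real \<times> real) set \<Rightarrow> (real \<times> real \<Rightarrow> real^3) \<Rightarrow> bool" where
  "local_param M U \<phi> \<longleftrightarrow>
     open U \<and> \<phi> differentiable_on U
     \<and> continuous_on U (partial_u \<phi>) \<and> continuous_on U (partial_v \<phi>)
     \<and> (\<forall>p\<in>U. cross3 (partial_u \<phi> p) (partial_v \<phi> p) \<noteq> 0)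
     \<and> (\<exists>\<psi>. homeomorphism U (\<phi> ` U) \<phi> \<psi>)
     \<and> openin (top_of_set M) (\<phi> ` U)"

definition regular_surface :: "(real^3) set \<Rightarrow> bool" where
  "regular_surface M \<longleftrightarrow> (\<forall>p\<in>M. \<exists>U \<phi>. local_param M U \<phi> \<and> p \<in> \<phi> ` U)"

text \<open>Both signs of the normal arise here, because a local parametrization may be precomposed
  with the exchange of its two parameters.  A coherent choice of sign along the curve is enforced
  by the differentiability of \<open>n\<close> required in the Darboux formulas.\<close>

definition unit_normal_along ::
    "(real^3) set \<Rightarrow> real set \<Rightarrow> (real \<Rightarrow> real^3) \<Rightarrow> (real \<Rightarrow> real^3) \<Rightarrow> bool" where
  "unit_normal_along M I \<gamma> n \<longleftrightarrow>
     (\<forall>x\<in>I. \<exists>U \<phi> p. local_param M U \<phi> \<and> p \<in> U \<and> \<phi> p = \<gamma> x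
        \<and> gal_cross (partial_u \<phi> p) (partial_v \<phi> p) \<noteq> 0
        \<and> n x = (1 / gal_norm (gal_cross (partial_u \<phi> p) (partial_v \<phi> p)))
                  *\<^sub>R gal_cross (partial_u \<phi> p) (partial_v \<phi> p))"

definition darboux_formulas ::
    "real set \<Rightarrow> (real \<Rightarrow> real^3) \<Rightarrow> (real \<Rightarrow> real^3) \<Rightarrow> (real \<Rightarrow> real^3)
      \<Rightarrow> (real \<Rightarrow> real) \<Rightarrow> (real \<Rightarrow> real) \<Rightarrow> (real \<Rightarrow> real) \<Rightarrow> bool" where
  "darboux_formulas I T Q n \<kappa>g \<kappa>n \<tau>g \<longleftrightarrow>
     (\<forall>x\<in>I. (T has_vector_derivative \<kappa>g x *\<^sub>R Q x + \<kappa>n x *\<^sub>R n x) (at x within I)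
        \<and> (Q has_vector_derivative \<tau>g x *\<^sub>R n x) (at x within I)
        \<and> (n has_vector_derivative - (\<tau>g x *\<^sub>R Q x)) (at x within I))"

text \<open>The Darboux frame with \<open>\<sigma> = 1\<close> has \<open>Q = n \<times> T\<close>, the one with \<open>\<sigma> = -1\<close> has \<open>Q = T \<times> n\<close>.
  Passing from one to the other changes the signs of \<open>\<kappa>g\<close> and \<open>\<tau>g\<close> and nothing else.  With
  \<open>n = (0, cos \<theta>, - sin \<theta>)\<close> the Darboux formulas give \<open>\<theta>' = - \<sigma> \<tau>g\<close>, so \<open>\<theta>\<close> is an indefinite
  integral of \<open>\<tau>g\<close> for \<open>Q = T \<times> n\<close>, but of \<open>- \<tau>g\<close> for \<open>Q = n \<times> T\<close>.\<close>

definition darboux_Q ::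
    "real \<Rightarrow> real set \<Rightarrow> (real \<Rightarrow> real^3) \<Rightarrow> (real \<Rightarrow> real^3) \<Rightarrow> real \<Rightarrow> real^3" where
  "darboux_Q \<sigma> I \<gamma> n x = \<sigma> *\<^sub>R gal_cross (n x) (tangent I \<gamma> x)"

definition indefinite_integral :: "real set \<Rightarrow> (real \<Rightarrow> real) \<Rightarrow> (real \<Rightarrow> real) \<Rightarrow> bool" where
  "indefinite_integral I f F \<longleftrightarrow> (\<forall>x\<in>I. (F has_real_derivative f x) (at x within I))"

end

theory Submission
  imports Defs
begin

text \<open>For a geodesic the Darboux formulas give \<open>T' = \<kappa>n n\<close>; as \<open>n\<close> is an isotropic unit vector and
  \<open>\<kappa>n > 0\<close>, the principal normal is \<open>n\<close> itself.  A continuous logarithm of \<open>n\<close>, read as a map from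
  the interval into the unit circle, yields an angle with \<open>n = (0, cos \<Theta>, - sin \<Theta>)\<close>, and
  \<open>n' = - \<tau>g Q\<close> identifies its derivative.  The components of \<open>T\<close> are then the indefinite
  integrals \<open>C\<close> and \<open>- S\<close>.\<close>

lemma gal_cross_nth [simp]:
  "gal_cross v w $ 1 = 0"
  "gal_cross v w $ 2 = v $ 3 * w $ 1 - v $ 1 * w $ 3"
  "gal_cross v w $ 3 = v $ 1 * w $ 2 - v $ 2 * w $ 1"
  by (simp_all add: gal_cross_def)

lemma gal_norm_isotropic:
  assumes "v $ 1 = 0"
  shows "gal_norm v = sqrt ((v $ 2)\<^sup>2 + (v $ 3)\<^sup>2)"
  using assms by (simp add: gal_norm_def gal_inner_def power2_eq_square)

lemma gal_norm_scaleR: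
  "gal_norm (c *\<^sub>R v) = \<bar>c\<bar> * gal_norm v"
proof -
  have "gal_inner (c *\<^sub>R v) (c *\<^sub>R v) = c\<^sup>2 * gal_inner v v"
    by (simp add: gal_inner_def power2_eq_square algebra_simps)
  then show ?thesis
    by (simp add: gal_norm_def abs_mult real_sqrt_mult)
qed

lemma isotropic_normalize:
  assumes "v $ 1 = 0" "v \<noteq> 0"
  shows "((1 / gal_norm v) *\<^sub>R v) $ 1 = 0"
    and "gal_norm ((1 / gal_norm v) *\<^sub>R v) = 1"
proof -
  have "v $ 2 \<noteq> 0 \<or> v $ 3 \<noteq> 0"
    using assms by (auto simp: vec_eq_iff forall_3)
  then have "gal_norm v > 0"
    using assms(1) by (auto simp: gal_norm_isotropic sum_power2_gt_zero_iff)
  then show "gal_norm ((1 / gal_norm v) *\<^sub>R v) = 1"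
    by (simp add: gal_norm_scaleR)
qed (use assms in simp)

text \<open>The Galilean cross product always has first component zero, and on isotropic vectors
  \<open>gal_norm\<close> is the Euclidean norm of the other two components, so dividing by it gives
  a point of the unit circle.\<close>

lemma unit_normal_along_isotropic_unit:
  assumes "unit_normal_along M I \<gamma> n" "x \<in> I"
  shows "n x $ 1 = 0" "gal_norm (n x) = 1"
proof -
  obtain v where "v $ 1 = 0" "v \<noteq> 0" "n x = (1 / gal_norm v) *\<^sub>R v"
    using assms unfolding unit_normal_along_def by (metis gal_cross_nth(1))
  then show "n x $ 1 = 0" "gal_norm (n x) = 1"
    using isotropic_normalize by auto
qed

text \<open>A connected set with two distinct points has no isolated point. This makes derivatives
  within \<open>I\<close> unique, endpoints included.\<close>

lemma param_interval_at_within: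
  assumes "param_interval I" "x \<in> I"
  shows "at x within I \<noteq> bot"
proof -
  obtain a b where "a \<in> I" "b \<in> I" "a \<noteq> b"
    using assms(1) unfolding param_interval_def by force
  moreover have "connected I"
    using assms(1) by (simp add: param_interval_def is_interval_connected)
  ultimately have "x islimpt I"
    using assms(2) connected_imp_perfect[of I x] by blast
  then show ?thesis
    by (simp add: trivial_limit_within)
qed

lemma has_real_derivative_nth:
  fixes f :: "real \<Rightarrow> real^'n"
  assumes "(f has_vector_derivative f') F"
  shows "((\<lambda>x. f x $ i) has_real_derivative f' $ i) F"
  using bounded_linear.has_vector_derivative[OF bounded_linear_vec_nth assms]
  by (simp add: has_real_derivative_iff_has_vector_derivative)

text \<open>An interval is contractible, so the nowhere vanishing function \<open>a + i b\<close>
  has a continuous logarithm. Modulus one forces its real part to vanish, and its imaginary part is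
  the angle.\<close>

lemma continuous_angle:
  fixes a b :: "real \<Rightarrow> real"
  assumes "is_interval I" "continuous_on I a" "continuous_on I b"
    and unit: "\<And>x. x \<in> I \<Longrightarrow> (a x)\<^sup>2 + (b x)\<^sup>2 = 1"
  obtains \<Theta> where "continuous_on I \<Theta>"
    and "\<And>x. x \<in> I \<Longrightarrow> a x = cos (\<Theta> x) \<and> b x = sin (\<Theta> x)"
proof -
  have "contractible I"
    using assms(1) by (simp add: is_interval_convex convex_imp_contractible)
  moreover have "continuous_on I (\<lambda>x. Complex (a x) (b x))"
    unfolding Complex_eq by (intro continuous_intros assms)
  moreover have "Complex (a x) (b x) \<noteq> 0" if "x \<in> I" for x
    using unit[OF that] by (auto simp: complex_eq_iff)
  ultimately obtain g where g: "continuous_on I g"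
      "\<And>x. x \<in> I \<Longrightarrow> Complex (a x) (b x) = exp (g x)"
    using continuous_logarithm_on_contractible[of I "\<lambda>x. Complex (a x) (b x)"] by metis
  show thesis
  proof
    show "continuous_on I (\<lambda>x. Im (g x))"
      by (intro continuous_intros g)
  next
    fix x assume x: "x \<in> I"
    have "exp (Re (g x)) = norm (Complex (a x) (b x))"
      using g(2)[OF x] by simp
    also have "\<dots> = 1"
      using unit[OF x] by (simp add: complex_norm)
    finally have "exp (Re (g x)) = 1" .
    then show "a x = cos (Im (g x)) \<and> b x = sin (Im (g x))"
      using g(2)[OF x] by (simp add: complex_eq_iff Re_exp Im_exp)
  qed
qed

text \<open>Near \<open>x\<close> the angle is \<open>\<Theta> x + arcsin (sin (\<Theta> y - \<Theta> x))\<close>, which turns continuity of \<open>\<Theta>\<close> into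
  differentiability.\<close>

lemma has_real_derivative_angle:
  fixes \<Theta> :: "real \<Rightarrow> real"
  assumes x: "x \<in> I" and cont: "continuous_on I \<Theta>"
    and cos: "((\<lambda>y. cos (\<Theta> y)) has_real_derivative - (d * sin (\<Theta> x))) (at x within I)"
    and sin: "((\<lambda>y. sin (\<Theta> y)) has_real_derivative d * cos (\<Theta> x)) (at x within I)"
  shows "(\<Theta> has_real_derivative d) (at x within I)"
proof -
  \<comment> \<open>This is \<open>sin (\<Theta> y - \<Theta> x)\<close> expanded, so that the two
    assumed derivatives apply to it directly.\<close>
  define s where "s y = sin (\<Theta> y) * cos (\<Theta> x) - cos (\<Theta> y) * sin (\<Theta> x)" for y
  have "(s has_real_derivative d * cos (\<Theta> x) * cos (\<Theta> x) + d * sin (\<Theta> x) * sin (\<Theta> x))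
      (at x within I)"
    unfolding s_def by (rule derivative_eq_intros cos sin refl | simp)+
  moreover have "d * cos (\<Theta> x) * cos (\<Theta> x) + d * sin (\<Theta> x) * sin (\<Theta> x) = d"
    using sin_cos_squared_add3[of "\<Theta> x"] by (simp add: mult.assoc flip: distrib_left)
  ultimately have s': "(s has_real_derivative d) (at x within I)"
    by simp
  \<comment> \<open>Since \<open>s x = 0\<close>, the slope of \<open>arcsin\<close> at this point
    is 1.\<close>
  have "(arcsin has_real_derivative inverse (sqrt (1 - (s x)\<^sup>2))) (at (s x))"
    by (rule DERIV_arcsin) (simp_all add: s_def)
  then have "(arcsin has_real_derivative 1) (at (s x))"
    by (simp add: s_def)
  then have D: "((\<lambda>y. \<Theta> x + arcsin (s y)) has_real_derivative d) (at x within I)"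
    using DERIV_add[OF DERIV_const DERIV_chain2[OF _ s']] by fastforce
  \<comment> \<open>On angle differences below \<open>pi / 2\<close>, \<open>arcsin\<close> inverts
    \<open>sin\<close>; continuity of \<Theta> provides such a neighbourhood.\<close>
  obtain e where e: "e > 0" "\<And>y. y \<in> I \<Longrightarrow> dist y x < e \<Longrightarrow> dist (\<Theta> y) (\<Theta> x) < pi / 2"
    using cont x pi_half_gt_zero unfolding continuous_on_iff by metis
  show ?thesis
  proof (rule has_field_derivative_transform_within[OF D e(1) x])
    fix y assume y: "y \<in> I" "dist y x < e"
    have "\<bar>\<Theta> y - \<Theta> x\<bar> < pi / 2"
      using e(2)[OF y] by (simp add: dist_real_def)
    then have "arcsin (sin (\<Theta> y - \<Theta> x)) = \<Theta> y - \<Theta> x"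
      by (intro arcsin_sin) linarith+
    then show "\<Theta> x + arcsin (s y) = \<Theta> y"
      by (simp add: s_def sin_diff)
  qed
qed

text \<open>The first coordinate of the curve is the parameter itself, and its derivative within
  \<open>I\<close> is unique.\<close>

lemma unit_speed_tangent:
  assumes "param_interval I" "unit_speed_curve I \<gamma>" "x \<in> I"
  shows "tangent I \<gamma> x $ 1 = 1"
proof -
  have nt: "at x within I \<noteq> bot"
    using assms by (simp add: param_interval_at_within)
  have "(\<gamma> has_vector_derivative tangent I \<gamma> x) (at x within I)"
    using assms(2,3) by (simp add: unit_speed_curve_def tangent_def vector_derivative_works)
  from has_real_derivative_nth[OF this, of 1]
  have "((\<lambda>y. y) has_real_derivative tangent I \<gamma> x $ 1) (at x within I)"
    by (rule has_field_derivative_transform_within[where d = 1])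
      (use assms(2,3) in \<open>auto simp: unit_speed_curve_def\<close>)
  moreover have "((\<lambda>y. y) has_real_derivative 1) (at x within I)"
    by (rule DERIV_ident)
  ultimately show ?thesis
    using vector_derivative_unique_within[OF nt]
    by (metis has_real_derivative_iff_has_vector_derivative)
qed

text \<open>The acceleration reduces to \<open>\<kappa>n n\<close>, of norm
  \<open>\<bar>\<kappa>n\<bar>\<close>. Positivity of \<open>\<kappa>n\<close> makes the normalised
  vector \<open>n\<close> and not \<open>- n\<close>.\<close>

lemma principal_normal_geodesic:
  assumes "param_interval I" "unit_normal_along M I \<gamma> n" "x \<in> I"
    and "darboux_formulas I (tangent I \<gamma>) Q n \<kappa>g \<kappa>n \<tau>g"
    and "\<kappa>g x = 0" "\<kappa>n x > 0"
  shows "principal_normal I \<gamma> x = n x"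
proof -
  have "(tangent I \<gamma> has_vector_derivative \<kappa>n x *\<^sub>R n x) (at x within I)"
    using assms(3-5) by (fastforce simp: darboux_formulas_def)
  then have "accel I \<gamma> x = \<kappa>n x *\<^sub>R n x"
    using assms(1,3) by (simp add: accel_def param_interval_at_within vector_derivative_within)
  then show ?thesis
    using assms(6) unit_normal_along_isotropic_unit(2)[OF assms(2,3)]
    by (simp add: principal_normal_def gal_curvature_def gal_norm_scaleR)
qed

text \<open>The indefinite integrals appear as existentially bound antiderivatives because their
  constants are tied to the curve: \<Theta> has to be an angle of the normal, and \<open>C\<close>
  and \<open>- S\<close> have to be the components of the tangent.\<close>

theorem theorem5:
  fixes I :: "real set" and M :: "(real^3) set"
    and \<gamma> n :: "real \<Rightarrow> real^3" and \<kappa>g \<kappa>n \<tau>g :: "real \<Rightarrow> real" and \<sigma> :: real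
  assumes "param_interval I"
    and "regular_surface M"
    and "unit_speed_curve I \<gamma>" and "\<gamma> ` I \<subseteq> M"
    and "\<forall>x\<in>I. gal_curvature I \<gamma> x > 0"
    and "unit_normal_along M I \<gamma> n"
    and "\<sigma> = 1 \<or> \<sigma> = -1"
    and "darboux_formulas I (tangent I \<gamma>) (darboux_Q \<sigma> I \<gamma> n) n \<kappa>g \<kappa>n \<tau>g"
    and geodesic: "\<forall>x\<in>I. \<kappa>g x = 0"
    and normal_orientation: "\<forall>x\<in>I. \<kappa>n x > 0"
  shows "\<exists>\<Theta> C S.
      indefinite_integral I (\<lambda>x. - \<sigma> * \<tau>g x) \<Theta>
    \<and> indefinite_integral I (\<lambda>x. \<kappa>n x * cos (\<Theta> x)) C
    \<and> indefinite_integral I (\<lambda>x. \<kappa>n x * sin (\<Theta> x)) S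
    \<and> (\<forall>x\<in>I.
         smarandache_TN I \<gamma> x =
           vector [1, C x + cos (\<Theta> x), - S x - sin (\<Theta> x)]
       \<and> smarandache_TB I \<gamma> x =
           vector [1, C x + sin (\<Theta> x), - S x + cos (\<Theta> x)]
       \<and> smarandache_TNB I \<gamma> x =
           vector [1, C x + cos (\<Theta> x) + sin (\<Theta> x), - S x + cos (\<Theta> x) - sin (\<Theta> x)])"
proof -
  have interval: "is_interval I"
    using assms(1) by (simp add: param_interval_def)
  note iso = unit_normal_along_isotropic_unit[OF assms(6)]
  note T1 = unit_speed_tangent[OF assms(1,3)]
  have T': "(tangent I \<gamma> has_vector_derivative \<kappa>n x *\<^sub>R n x) (at x within I)"
    and n': "(n has_vector_derivative - (\<tau>g x *\<^sub>R darboux_Q \<sigma> I \<gamma> n x)) (at x within I)"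
    if "x \<in> I" for x
    using assms(8) geodesic that by (fastforce simp: darboux_formulas_def)+
  \<comment> \<open>With \<open>n\<close> isotropic and the tangent having first component 1,
    \<open>Q = \<sigma> (0, n3, - n2)\<close>, so \<open>n\<close> rotates in the isotropic
    plane.\<close>
  have n2': "((\<lambda>y. n y $ 2) has_real_derivative - (\<tau>g x * (\<sigma> * n x $ 3))) (at x within I)"
    and n3': "((\<lambda>y. n y $ 3) has_real_derivative \<tau>g x * (\<sigma> * n x $ 2)) (at x within I)"
    if "x \<in> I" for x
    using has_real_derivative_nth[OF n'[OF that], of 2] has_real_derivative_nth[OF n'[OF that], of 3]
      iso(1)[OF that] T1[OF that]
    by (simp_all add: darboux_Q_def mult.assoc)
  \<comment> \<open>The third component is negated to match
    \<open>n = (0, cos \<Theta>, - sin \<Theta>)\<close>.\<close>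
  have unit: "(n x $ 2)\<^sup>2 + (- n x $ 3)\<^sup>2 = 1" if "x \<in> I" for x
    using iso[OF that] by (simp add: gal_norm_isotropic)
  have cont_n: "continuous_on I (\<lambda>x. n x $ 2)" "continuous_on I (\<lambda>x. - n x $ 3)"
    by (rule continuous_on_minus DERIV_continuous_on[OF n2'] DERIV_continuous_on[OF n3'] | assumption)+
  obtain \<Theta> where cont: "continuous_on I \<Theta>"
    and \<Theta>: "\<And>x. x \<in> I \<Longrightarrow> n x $ 2 = cos (\<Theta> x) \<and> - n x $ 3 = sin (\<Theta> x)"
    using continuous_angle[OF interval cont_n unit] by blast
  have n3: "n x $ 3 = - sin (\<Theta> x)" if "x \<in> I" for x
    using \<Theta>[OF that] by simp
  have \<Theta>': "(\<Theta> has_real_derivative - \<sigma> * \<tau>g x) (at x within I)" if x: "x \<in> I" for x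
  proof (rule has_real_derivative_angle[OF x cont])
    show "((\<lambda>y. cos (\<Theta> y)) has_real_derivative - (- \<sigma> * \<tau>g x * sin (\<Theta> x))) (at x within I)"
      using has_field_derivative_transform_within[OF n2'[OF x] zero_less_one x] \<Theta> n3 x
      by (simp add: mult_ac)
    show "((\<lambda>y. sin (\<Theta> y)) has_real_derivative - \<sigma> * \<tau>g x * cos (\<Theta> x)) (at x within I)"
      using has_field_derivative_transform_within[OF DERIV_minus[OF n3'[OF x]] zero_less_one x] \<Theta> x
      by (simp add: mult_ac)
  qed
  have N: "principal_normal I \<gamma> x = n x" if "x \<in> I" for x
    using principal_normal_geodesic[OF assms(1,6) that assms(8)] geodesic normal_orientation that
    by blast
  show ?thesis
  proof (intro exI conjI ballI)
    show "indefinite_integral I (\<lambda>x. - \<sigma> * \<tau>g x) \<Theta>"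
      using \<Theta>' by (simp add: indefinite_integral_def)
    show "indefinite_integral I (\<lambda>x. \<kappa>n x * cos (\<Theta> x)) (\<lambda>x. tangent I \<gamma> x $ 2)"
      using has_real_derivative_nth[OF T', of _ 2] \<Theta> by (simp add: indefinite_integral_def)
    show "indefinite_integral I (\<lambda>x. \<kappa>n x * sin (\<Theta> x)) (\<lambda>x. - tangent I \<gamma> x $ 3)"
      using DERIV_minus[OF has_real_derivative_nth[OF T', of _ 3]] n3
      by (simp add: indefinite_integral_def)
  \<comment> \<open>The binormal is \<open>T \<times> n = (0, sin \<Theta>, cos \<Theta>)\<close>,
    whichever sign \<sigma> has.\<close>
  qed (use iso(1) T1 \<Theta> n3 in \<open>simp_all add: smarandache_TN_def smarandache_TB_def
      smarandache_TNB_def binormal_def N vec_eq_iff forall_3\<close>)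
qed

end
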